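(* Let $\mathcal X=(\Omega,S)$ be a coherent configuration of degree $n$, maximal valency $k$ and indistinguishing number $c$, and suppose $n>3c(k-1)k$. Then for every point $\mu\in\Omega$, every coherent configuration $\mathcal X'=(\Omega',S')$, every algebraic isomorphism $\varphi:\mathcal X\to\mathcal X'$, and every $\mu'\in\Omega'$ with $\varphi(r_{\mathcal X}(\mu,\mu))=r_{\mathcal X'}(\mu',\mu')$, the algebraic isomorphism $\varphi$ is induced by an isomorphism $f:\Omega\to\Omega'$ with $\mu^f=\mu'$. In particular, $\mathcal X$ is separable.
   Context: A coherent configuration is a pair $\mathcal X=(\Omega,S)$, where $\Omega$ is a finite set and $S$ is a partition of $\Omega\times\Omega$ such that the diagonal $1_\Omega$ is a union of elements of $S$, $S$ is closed under $r\mapsto r^*=\{(\beta,\alpha):(\alpha,\beta)\in r\}$, and for all $r,s,t\in S$ the number $c_{rs}^t=|\alpha r\cap\beta s^*|$ does not depend on $(\alpha,\beta)\in t$, where $\alpha r=\{\beta:(\alpha,\beta)\in r\}$. $r_{\mathcal X}(\alpha,\beta)$ is the element of $S$ containing $(\alpha,\beta)$. The degree is $|\Omega|$. The valency of $s\in S$ is $n_s=|\alpha s|$ for any $\alpha$ with $\alpha s\ne\varnothing$; the maximal valency is $\max_{s\in S}n_s$. For $s\in S$, $c(s)=\sum_{r\in S}c_{rr^*}^s$, which equals $|\{\gamma\in\Omega:r(\gamma,\alpha)=r(\gamma,\beta)\}|$ for any $(\alpha,\beta)\in s$; the indistinguishing number of $\mathcal X$ is the maximum of $c(s)$ over irreflexive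 $s\in S$ (i.e. $s\cap 1_\Omega=\varnothing$). An isomorphism from $\mathcal X$ to $\mathcal X'=(\Omega',S')$ is a bijection $f:\Omega\to\Omega'$ with $\{s^f:s\in S\}=S'$; an algebraic isomorphism is a bijection $\varphi:S\to S'$ with $c_{rs}^t=c_{\varphi(r)\varphi(s)}^{\varphi(t)}$ for all $r,s,t$; it is induced by $f$ if $\varphi(s)=s^f$ for all $s$. $\mathcal X$ is separable if every algebraic isomorphism from $\mathcal X$ to any coherent configuration is induced by an isomorphism. *)

theory Defs
  imports Main "HOL-Library.Disjoint_Sets"
begin

text \<open>
  In relational notation the set \<open>\<alpha>r\<close> of all \<open>\<beta>\<close> with \<open>(\<alpha>, \<beta>) \<in> r\<close> is \<open>r `` {\<alpha>}\<close>, and \<open>r\<^sup>*\<close> is the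
  converse \<open>r\<inverse>\<close>.
\<close>

locale coherent_configuration =
  fixes \<Omega> :: "'a set" and S :: "('a \<times> 'a) set set"
  assumes finite_points: "finite \<Omega>"
    and partition: "partition_on (\<Omega> \<times> \<Omega>) S"
    and diagonal: "\<exists>D \<subseteq> S. \<Union>D = Id_on \<Omega>"
    and converse_closed: "s \<in> S \<Longrightarrow> s\<inverse> \<in> S"
    and coherent: "\<lbrakk>r \<in> S; s \<in> S; t \<in> S; (\<alpha>, \<beta>) \<in> t; (\<alpha>', \<beta>') \<in> t\<rbrakk> \<Longrightarrow>
        card (r `` {\<alpha>} \<inter> s\<inverse> `` {\<beta>}) = card (r `` {\<alpha>'} \<inter> s\<inverse> `` {\<beta>'})"

definition intersection_number ::
  "('a \<times> 'a) set \<Rightarrow> ('a \<times> 'a) set \<Rightarrow> ('a \<times> 'a) set \<Rightarrow> nat" where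
  "intersection_number r s t =
     (THE m. \<forall>(\<alpha>, \<beta>) \<in> t. card (r `` {\<alpha>} \<inter> s\<inverse> `` {\<beta>}) = m)"

definition basis_relation_of :: "('a \<times> 'a) set set \<Rightarrow> 'a \<Rightarrow> 'a \<Rightarrow> ('a \<times> 'a) set" where
  "basis_relation_of S \<alpha> \<beta> = (THE s. s \<in> S \<and> (\<alpha>, \<beta>) \<in> s)"

definition valency :: "('a \<times> 'a) set \<Rightarrow> nat" where
  "valency s = (THE m. \<forall>\<alpha>. s `` {\<alpha>} \<noteq> {} \<longrightarrow> card (s `` {\<alpha>}) = m)"

definition maximal_valency :: "('a \<times> 'a) set set \<Rightarrow> nat" where
  "maximal_valency S = Max (valency ` S)"

definition relation_indistinguishing_number ::
  "('a \<times> 'a) set set \<Rightarrow> ('a \<times> 'a) set \<Rightarrow> nat" where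
  "relation_indistinguishing_number S s = (\<Sum>r\<in>S. intersection_number r (r\<inverse>) s)"

text \<open>
  A one-point configuration has no irreflexive basis relation; inserting \<open>0\<close> gives it
  indistinguishing number \<open>0\<close> and changes nothing otherwise.
\<close>

definition indistinguishing_number :: "'a set \<Rightarrow> ('a \<times> 'a) set set \<Rightarrow> nat" where
  "indistinguishing_number \<Omega> S =
     Max (insert 0 (relation_indistinguishing_number S ` {s \<in> S. s \<inter> Id_on \<Omega> = {}}))"

definition isomorphism ::
  "'a set \<Rightarrow> ('a \<times> 'a) set set \<Rightarrow> 'b set \<Rightarrow> ('b \<times> 'b) set set \<Rightarrow> ('a \<Rightarrow> 'b) \<Rightarrow> bool" where
  "isomorphism \<Omega> S \<Omega>' S' f \<longleftrightarrow>
     bij_betw f \<Omega> \<Omega>' \<and> (\<lambda>s. map_prod f f ` s) ` S = S'"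

definition algebraic_isomorphism ::
  "('a \<times> 'a) set set \<Rightarrow> ('b \<times> 'b) set set \<Rightarrow> (('a \<times> 'a) set \<Rightarrow> ('b \<times> 'b) set) \<Rightarrow> bool" where
  "algebraic_isomorphism S S' \<phi> \<longleftrightarrow>
     bij_betw \<phi> S S' \<and>
     (\<forall>r\<in>S. \<forall>s\<in>S. \<forall>t\<in>S.
        intersection_number r s t = intersection_number (\<phi> r) (\<phi> s) (\<phi> t))"

definition induced_by ::
  "('a \<times> 'a) set set \<Rightarrow> (('a \<times> 'a) set \<Rightarrow> ('b \<times> 'b) set) \<Rightarrow> ('a \<Rightarrow> 'b) \<Rightarrow> bool" where
  "induced_by S \<phi> f \<longleftrightarrow> (\<forall>s\<in>S. \<phi> s = map_prod f f ` s)"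

text \<open>
  HOL cannot quantify over types inside a formula, so the type of the points of the target
  configurations is a parameter.  Separability in the usual sense, with targets on arbitrary
  finite sets, is separability with respect to every type \<open>'b\<close>; a theorem concluding
  \<open>separable TYPE('b) \<Omega> S\<close> for a type variable \<open>'b\<close> says exactly this.
\<close>

definition separable :: "'b itself \<Rightarrow> 'a set \<Rightarrow> ('a \<times> 'a) set set \<Rightarrow> bool" where
  "separable (_ :: 'b itself) \<Omega> S \<longleftrightarrow>
     (\<forall>(\<Omega>' :: 'b set) S' \<phi>.
        coherent_configuration \<Omega>' S' \<longrightarrow> algebraic_isomorphism S S' \<phi> \<longrightarrow>
        (\<exists>f. isomorphism \<Omega> S \<Omega>' S' f \<and> induced_by S \<phi> f))"

text \<open>The definite descriptions above are well defined.\<close>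

context coherent_configuration
begin

lemma intersection_number_eq:
  assumes "r \<in> S" "s \<in> S" "t \<in> S" "(\<alpha>, \<beta>) \<in> t"
  shows "intersection_number r s t = card (r `` {\<alpha>} \<inter> s\<inverse> `` {\<beta>})"
  unfolding intersection_number_def
proof (rule the_equality)
  show "\<forall>(a, b) \<in> t. card (r `` {a} \<inter> s\<inverse> `` {b}) = card (r `` {\<alpha>} \<inter> s\<inverse> `` {\<beta>})"
    using coherent[OF assms(1-3) _ assms(4)] by blast
qed (use assms(4) in fastforce)

lemma basis_relation_of_eq:
  assumes "s \<in> S" "(\<alpha>, \<beta>) \<in> s"
  shows "basis_relation_of S \<alpha> \<beta> = s"
  unfolding basis_relation_of_def
proof (rule the_equality)
  show "s' = s" if "s' \<in> S \<and> (\<alpha>, \<beta>) \<in> s'" for s'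
    using partition_onD2[OF partition] that assms unfolding disjoint_def by blast
qed (use assms in blast)

lemma basis_relation_of:
  assumes "\<alpha> \<in> \<Omega>" "\<beta> \<in> \<Omega>"
  shows "basis_relation_of S \<alpha> \<beta> \<in> S" "(\<alpha>, \<beta>) \<in> basis_relation_of S \<alpha> \<beta>"
proof -
  obtain s where "s \<in> S" "(\<alpha>, \<beta>) \<in> s"
    using partition_onD1[OF partition] assms by blast
  then show "basis_relation_of S \<alpha> \<beta> \<in> S" "(\<alpha>, \<beta>) \<in> basis_relation_of S \<alpha> \<beta>"
    using basis_relation_of_eq by auto
qed

lemma basis_relation_subset: "s \<in> S \<Longrightarrow> s \<subseteq> \<Omega> \<times> \<Omega>"
  using partition_onD1[OF partition] by blast

lemma valency_unique:
  assumes s: "s \<in> S" and "s `` {\<alpha>} \<noteq> {}" "s `` {\<beta>} \<noteq> {}"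
  shows "card (s `` {\<alpha>}) = card (s `` {\<beta>})"
proof -
  have *: "card (s `` {a}) = intersection_number s (s\<inverse>) (basis_relation_of S a a)"
    if "s `` {a} \<noteq> {}" for a
  proof -
    from that have "a \<in> \<Omega>" using basis_relation_subset[OF s] by blast
    then show ?thesis
      using intersection_number_eq[OF s converse_closed[OF s] basis_relation_of[of a a]] by simp
  qed
  obtain \<gamma> where \<gamma>: "(\<alpha>, \<gamma>) \<in> s" using assms by blast
  obtain \<delta> where \<delta>: "(\<beta>, \<delta>) \<in> s" using assms by blast
  have \<Omega>: "\<alpha> \<in> \<Omega>" "\<beta> \<in> \<Omega>" using basis_relation_subset[OF s] \<gamma> \<delta> by auto
  let ?u = "basis_relation_of S \<alpha> \<alpha>"
  have u: "?u \<in> S" "(\<alpha>, \<alpha>) \<in> ?u" using basis_relation_of \<Omega> by auto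
  have uId: "?u \<subseteq> Id_on \<Omega>"
  proof -
    obtain D where D: "D \<subseteq> S" "\<Union>D = Id_on \<Omega>" using diagonal by blast
    then obtain d where "d \<in> D" "(\<alpha>, \<alpha>) \<in> d" using \<Omega> by blast
    with D show ?thesis using basis_relation_of_eq by blast
  qed
  have "card (?u `` {\<alpha>} \<inter> s\<inverse> `` {\<gamma>}) = card (?u `` {\<beta>} \<inter> s\<inverse> `` {\<delta>})"
    by (rule coherent[OF u(1) s s \<gamma> \<delta>])
  moreover have "?u `` {\<alpha>} \<inter> s\<inverse> `` {\<gamma>} = {\<alpha>}" using u uId \<gamma> by blast
  ultimately have "?u `` {\<beta>} \<inter> s\<inverse> `` {\<delta>} \<noteq> {}" by auto
  then have "(\<beta>, \<beta>) \<in> ?u" using uId by blast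
  then have "basis_relation_of S \<beta> \<beta> = ?u" using u basis_relation_of_eq by blast
  then show ?thesis using * assms by simp
qed

lemma valency_eq:
  assumes "s \<in> S" "s `` {\<alpha>} \<noteq> {}"
  shows "valency s = card (s `` {\<alpha>})"
  unfolding valency_def
proof (rule the_equality)
  show "\<forall>a. s `` {a} \<noteq> {} \<longrightarrow> card (s `` {a}) = card (s `` {\<alpha>})"
    using valency_unique assms by blast
qed (use assms in blast)

end

end

theory Submission
  imports Defs
begin

text \<open>
  Fix \<open>\<mu>\<close>, and say that \<open>\<gamma>\<close> determines \<open>\<beta>\<close> if \<open>\<beta>\<close> is the only point with its colours to \<open>\<mu>\<close> and
  \<open>\<gamma>\<close>; all but \<open>c(k - 1)\<close> points \<open>\<gamma>\<close> do.  If \<open>\<gamma>\<close> determines \<open>\<beta>\<close>, a partial map to \<open>\<Omega>'\<close> defined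
  at \<open>\<mu>\<close> and \<open>\<gamma>\<close> has only one candidate for the image of \<open>\<beta>\<close>.  Propagating images along such
  pairs is a covering-space construction, and the point is that its monodromy is trivial.  Call a
  path \<open>\<beta>, \<gamma>, \<delta>\<close> rigid if the colours of its two edges and those of \<open>\<mu>\<beta>\<close> and \<open>\<mu>\<delta>\<close> force the
  colour of \<open>\<beta>\<delta>\<close>; such a triangle closes in \<open>\<Omega>'\<close> too.  For fixed \<open>\<beta>, \<delta>\<close> all but
  \<open>c(k - 1)k\<close> points \<open>\<gamma>\<close> give a rigid path, so as \<open>n > 3c(k - 1)k\<close> every triangle is the base of a
  cone whose three other faces are rigid; it therefore closes if its edges come from determination,
  which is a symmetric relation among the points \<open>\<beta>\<close> with \<open>|\<mu>r(\<mu>, \<beta>)|\<close> maximal.  Four-cycles are then closed by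
  coning them off with a point determining all four vertices, and the resulting map preserves the
  colour of an arbitrary pair because some rigid path joins it.
\<close>

section \<open>Colours of pairs, and points that fail to separate or to determine others\<close>

context coherent_configuration
begin

abbreviation R :: "'a \<Rightarrow> 'a \<Rightarrow> ('a \<times> 'a) set" where
  "R \<equiv> basis_relation_of S"

lemma mem_basis_relation_iff:
  assumes "\<alpha> \<in> \<Omega>" "\<beta> \<in> \<Omega>" "s \<in> S"
  shows "(\<alpha>, \<beta>) \<in> s \<longleftrightarrow> R \<alpha> \<beta> = s"
  using assms basis_relation_of basis_relation_of_eq by blast

lemma basis_relation_nonempty:
  assumes "s \<in> S"
  obtains \<alpha> \<beta> where "\<alpha> \<in> \<Omega>" "\<beta> \<in> \<Omega>" "s = R \<alpha> \<beta>"
proof -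
  have "s \<noteq> {}" using partition_onD3[OF partition] assms by auto
  then obtain \<alpha> \<beta> where "(\<alpha>, \<beta>) \<in> s" by auto
  then show ?thesis
    using that basis_relation_subset[OF assms] basis_relation_of_eq[OF assms] by blast
qed

lemma intersection_number_basis_relation_of:
  assumes "\<alpha> \<in> \<Omega>" "\<beta> \<in> \<Omega>" "r \<in> S" "s \<in> S"
  shows "intersection_number r s (R \<alpha> \<beta>) = card {\<gamma> \<in> \<Omega>. R \<alpha> \<gamma> = r \<and> R \<gamma> \<beta> = s}"
proof -
  have "r `` {\<alpha>} \<inter> s\<inverse> `` {\<beta>} = {\<gamma> \<in> \<Omega>. R \<alpha> \<gamma> = r \<and> R \<gamma> \<beta> = s}"
    using assms basis_relation_subset[OF assms(3)] mem_basis_relation_iff by blast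
  then show ?thesis
    using intersection_number_eq[OF assms(3,4) basis_relation_of[OF assms(1,2)]] by simp
qed

lemma basis_relation_of_converse:
  assumes "\<alpha> \<in> \<Omega>" "\<beta> \<in> \<Omega>"
  shows "R \<beta> \<alpha> = (R \<alpha> \<beta>)\<inverse>"
  using basis_relation_of_eq converse_closed basis_relation_of[OF assms] by blast

lemma basis_relation_of_diagonal:
  assumes "\<alpha> \<in> \<Omega>"
  shows "R \<alpha> \<alpha> \<subseteq> Id_on \<Omega>"
proof -
  obtain D where D: "D \<subseteq> S" "\<Union>D = Id_on \<Omega>" using diagonal by blast
  then obtain d where "d \<in> D" "(\<alpha>, \<alpha>) \<in> d" using assms by blast
  with D show ?thesis using basis_relation_of_eq by blast
qed

lemma basis_relation_of_diagonal_eqD: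
  assumes "\<alpha> \<in> \<Omega>" "\<beta> \<in> \<Omega>" "\<gamma> \<in> \<Omega>" "R \<beta> \<gamma> = R \<alpha> \<alpha>"
  shows "\<beta> = \<gamma>"
  using basis_relation_of(2)[of \<beta> \<gamma>] basis_relation_of_diagonal[of \<alpha>] assms by auto

lemma finite_basis_relations: "finite S"
  using finite_subset[of S "Pow (\<Omega> \<times> \<Omega>)"] basis_relation_subset finite_points by auto

lemma card_out_neighbours_le:
  assumes "\<alpha> \<in> \<Omega>" "s \<in> S"
  shows "card {\<gamma> \<in> \<Omega>. R \<alpha> \<gamma> = s} \<le> maximal_valency S"
proof -
  have eq: "{\<gamma> \<in> \<Omega>. R \<alpha> \<gamma> = s} = s `` {\<alpha>}"
    using assms basis_relation_subset[OF assms(2)] mem_basis_relation_iff by blast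
  show ?thesis
  proof (cases "s `` {\<alpha>} = {}")
    case False
    then show ?thesis
      using eq valency_eq[OF assms(2) False] assms(2) finite_basis_relations
      unfolding maximal_valency_def by (metis Max_ge finite_imageI imageI)
  qed (simp add: eq)
qed

lemma card_in_neighbours_le:
  assumes "\<alpha> \<in> \<Omega>" "s \<in> S"
  shows "card {\<gamma> \<in> \<Omega>. R \<gamma> \<alpha> = s} \<le> maximal_valency S"
proof -
  have "{\<gamma> \<in> \<Omega>. R \<gamma> \<alpha> = s} = {\<gamma> \<in> \<Omega>. R \<alpha> \<gamma> = s\<inverse>}"
    using basis_relation_of_converse[OF _ assms(1)] by auto
  then show ?thesis using card_out_neighbours_le[of \<alpha> "s\<inverse>"] assms converse_closed by simp
qed

text \<open>Sorting the points \<open>\<gamma>\<close> by the colour \<open>r\<close> of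
  \<open>(\<alpha>, \<gamma>)\<close> splits the set into classes counted by the intersection
  numbers of \<open>r\<close>, \<open>r\<inverse>\<close> over the colour of
  \<open>(\<alpha>, \<beta>)\<close>.\<close>

lemma card_indistinguishing_le:
  assumes "\<alpha> \<in> \<Omega>" "\<beta> \<in> \<Omega>" "\<alpha> \<noteq> \<beta>"
  shows "card {\<gamma> \<in> \<Omega>. R \<gamma> \<alpha> = R \<gamma> \<beta>} \<le> indistinguishing_number \<Omega> S"
proof -
  let ?A = "\<lambda>r. {\<gamma> \<in> \<Omega>. R \<alpha> \<gamma> = r \<and> R \<gamma> \<beta> = r\<inverse>}"
  \<comment> \<open>A colour that contains a loop is a diagonal colour. Hence distinct points have
    an irreflexive colour, one of those over which the maximum is taken.\<close>
  have "R \<alpha> \<beta> \<inter> Id_on \<Omega> = {}"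
  proof -
    have "\<gamma> \<in> \<Omega> \<Longrightarrow> (\<gamma>, \<gamma>) \<notin> R \<alpha> \<beta>" for \<gamma>
      using basis_relation_of_diagonal_eqD[of \<gamma> \<alpha> \<beta>] assms
        mem_basis_relation_iff[of \<gamma> \<gamma> "R \<alpha> \<beta>"] basis_relation_of by metis
    then show ?thesis by auto
  qed
  then have le: "relation_indistinguishing_number S (R \<alpha> \<beta>) \<le> indistinguishing_number \<Omega> S"
    unfolding indistinguishing_number_def
    using assms basis_relation_of finite_basis_relations by (intro Max_ge) auto
  have "{\<gamma> \<in> \<Omega>. R \<gamma> \<alpha> = R \<gamma> \<beta>} = (\<Union>r\<in>S. ?A r)"
    using basis_relation_of_converse[OF assms(1)] basis_relation_of(1)[OF assms(1)] by auto
  moreover have "card (\<Union>r\<in>S. ?A r) = (\<Sum>r\<in>S. card (?A r))"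
    using finite_basis_relations finite_points by (intro card_UN_disjoint) auto
  moreover have "\<dots> = relation_indistinguishing_number S (R \<alpha> \<beta>)"
    unfolding relation_indistinguishing_number_def
    using intersection_number_basis_relation_of assms converse_closed by (intro sum.cong) auto
  ultimately show ?thesis using le by simp
qed

lemma maximal_valency_pos:
  assumes "\<mu> \<in> \<Omega>"
  shows "maximal_valency S > 0"
proof -
  have "card {\<gamma> \<in> \<Omega>. R \<mu> \<gamma> = R \<mu> \<mu>} > 0"
    using assms finite_points by (auto simp: card_gt_0_iff)
  then show ?thesis
    using card_out_neighbours_le[OF assms basis_relation_of(1)[OF assms assms]] by linarith
qed

text \<open>
  \<open>orbit \<mu> \<beta>\<close> is \<open>\<mu>r\<close> for \<open>r = r(\<mu>, \<beta>)\<close>: it need not be the orbit of a group, but plays the role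
  of the orbit of \<open>\<beta>\<close> under the stabilizer of \<open>\<mu>\<close>.
\<close>

definition orbit :: "'a \<Rightarrow> 'a \<Rightarrow> 'a set" where
  "orbit \<mu> \<beta> = {\<gamma> \<in> \<Omega>. R \<mu> \<gamma> = R \<mu> \<beta>}"

definition determines :: "'a \<Rightarrow> 'a \<Rightarrow> 'a \<Rightarrow> bool" where
  "determines \<mu> \<gamma> \<beta> \<longleftrightarrow> (\<forall>\<beta>\<^sub>1 \<in> orbit \<mu> \<beta>. R \<gamma> \<beta>\<^sub>1 = R \<gamma> \<beta> \<longrightarrow> \<beta>\<^sub>1 = \<beta>)"

text \<open>Keeping \<open>\<mu>\<close> and \<open>\<delta>\<close> in place loses nothing, since
  coherence carries any pair of the same colour back to \<open>(\<mu>, \<delta>)\<close>. No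
  condition ties \<open>\<gamma>\<^sub>1\<close> to \<open>\<mu>\<close>.\<close>

definition rigid :: "'a \<Rightarrow> 'a \<Rightarrow> 'a \<Rightarrow> 'a \<Rightarrow> bool" where
  "rigid \<mu> \<beta> \<gamma> \<delta> \<longleftrightarrow> (\<forall>\<beta>\<^sub>1 \<in> orbit \<mu> \<beta>. \<forall>\<gamma>\<^sub>1\<in>\<Omega>.
     R \<beta>\<^sub>1 \<gamma>\<^sub>1 = R \<beta> \<gamma> \<longrightarrow> R \<gamma>\<^sub>1 \<delta> = R \<gamma> \<delta> \<longrightarrow> R \<beta>\<^sub>1 \<delta> = R \<beta> \<delta>)"

lemma finite_orbit [simp]: "finite (orbit \<mu> \<beta>)"
  using finite_points by (simp add: orbit_def)

text \<open>A point that does not determine \<open>\<beta>\<close> fails to separate it from one of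
  the at most \<open>maximal_valency S - 1\<close> other points of its orbit, and each of these
  accounts for at most \<open>indistinguishing_number \<Omega> S\<close> failures.\<close>

lemma card_not_determines_le:
  assumes "\<mu> \<in> \<Omega>" "\<beta> \<in> \<Omega>"
  shows "card {\<gamma> \<in> \<Omega>. \<not> determines \<mu> \<gamma> \<beta>}
    \<le> indistinguishing_number \<Omega> S * (maximal_valency S - 1)"
proof -
  let ?B = "orbit \<mu> \<beta> - {\<beta>}"
  let ?C = "\<lambda>\<beta>\<^sub>1. {\<gamma> \<in> \<Omega>. R \<gamma> \<beta>\<^sub>1 = R \<gamma> \<beta>}"
  have "{\<gamma> \<in> \<Omega>. \<not> determines \<mu> \<gamma> \<beta>} \<subseteq> (\<Union>\<beta>\<^sub>1\<in>?B. ?C \<beta>\<^sub>1)"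
    unfolding determines_def by auto
  then have "card {\<gamma> \<in> \<Omega>. \<not> determines \<mu> \<gamma> \<beta>} \<le> card (\<Union>\<beta>\<^sub>1\<in>?B. ?C \<beta>\<^sub>1)"
    using finite_points by (intro card_mono) auto
  also have "\<dots> \<le> (\<Sum>\<beta>\<^sub>1\<in>?B. card (?C \<beta>\<^sub>1))" by (intro card_UN_le) simp
  also have "\<dots> \<le> card ?B * indistinguishing_number \<Omega> S"
    using card_indistinguishing_le assms
    by (intro sum_bounded_above[where 'a = nat, simplified]) (auto simp: orbit_def)
  also have "\<dots> \<le> (maximal_valency S - 1) * indistinguishing_number \<Omega> S"
  proof -
    have "\<beta> \<in> orbit \<mu> \<beta>" using assms by (simp add: orbit_def)
    then have "card ?B = card (orbit \<mu> \<beta>) - 1" by simp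
    then show ?thesis
      using card_out_neighbours_le[of \<mu> "R \<mu> \<beta>"] assms basis_relation_of
      unfolding orbit_def by (intro mult_right_mono) auto
  qed
  finally show ?thesis by (simp add: mult.commute)
qed

end

section \<open>Partial maps compatible with an algebraic isomorphism\<close>

locale algebraically_isomorphic_configurations =
  X: coherent_configuration \<Omega> S + X': coherent_configuration \<Omega>' S'
  for \<Omega> :: "'a set" and S and \<Omega>' :: "'b set" and S' +
  fixes \<phi> :: "('a \<times> 'a) set \<Rightarrow> ('b \<times> 'b) set"
  assumes algebraic_isomorphism: "algebraic_isomorphism S S' \<phi>"
begin

text \<open>The primed points are the proposed images: \<open>matched \<alpha> \<alpha>' \<beta> \<beta>'\<close> allows \<open>\<alpha> \<mapsto> \<alpha>'\<close>, \<open>\<beta> \<mapsto> \<beta>'\<close>.\<close>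

definition matched :: "'a \<Rightarrow> 'b \<Rightarrow> 'a \<Rightarrow> 'b \<Rightarrow> bool" where
  "matched \<alpha> \<alpha>' \<beta> \<beta>' \<longleftrightarrow> \<phi> (X.R \<alpha> \<beta>) = X'.R \<alpha>' \<beta>'"

lemma image_in: "s \<in> S \<Longrightarrow> \<phi> s \<in> S'"
  using algebraic_isomorphism bij_betwE unfolding algebraic_isomorphism_def by blast

lemma image_eq_iff: "r \<in> S \<Longrightarrow> s \<in> S \<Longrightarrow> \<phi> r = \<phi> s \<longleftrightarrow> r = s"
  using algebraic_isomorphism unfolding algebraic_isomorphism_def bij_betw_def
  by (auto dest: inj_onD)

lemma preimage:
  assumes "\<alpha>' \<in> \<Omega>'" "\<beta>' \<in> \<Omega>'"
  obtains s where "s \<in> S" "\<phi> s = X'.R \<alpha>' \<beta>'"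
  using X'.basis_relation_of(1)[OF assms] algebraic_isomorphism
  unfolding algebraic_isomorphism_def bij_betw_def by (metis imageE)

text \<open>Preservation of intersection numbers enters here only. It says that a matched edge
  supports equally many triangles of each kind on both sides; \<open>push\<close> and
  \<open>pull\<close> are the case of a nonzero count.\<close>

lemma card_matched:
  assumes "\<alpha> \<in> \<Omega>" "\<beta> \<in> \<Omega>" "\<alpha>' \<in> \<Omega>'" "\<beta>' \<in> \<Omega>'" "matched \<alpha> \<alpha>' \<beta> \<beta>'" "r \<in> S" "s \<in> S"
  shows "card {\<gamma> \<in> \<Omega>. X.R \<alpha> \<gamma> = r \<and> X.R \<gamma> \<beta> = s} =
    card {\<gamma>' \<in> \<Omega>'. X'.R \<alpha>' \<gamma>' = \<phi> r \<and> X'.R \<gamma>' \<beta>' = \<phi> s}"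
proof -
  have "intersection_number r s (X.R \<alpha> \<beta>) = intersection_number (\<phi> r) (\<phi> s) (X'.R \<alpha>' \<beta>')"
    using algebraic_isomorphism assms X.basis_relation_of
    unfolding algebraic_isomorphism_def matched_def by metis
  then show ?thesis
    using assms by (simp add: X.intersection_number_basis_relation_of
        X'.intersection_number_basis_relation_of image_in)
qed

lemma push:
  assumes "\<alpha> \<in> \<Omega>" "\<beta> \<in> \<Omega>" "\<alpha>' \<in> \<Omega>'" "\<beta>' \<in> \<Omega>'" "matched \<alpha> \<alpha>' \<beta> \<beta>'" "\<gamma> \<in> \<Omega>"
  obtains \<gamma>' where "\<gamma>' \<in> \<Omega>'" "matched \<alpha> \<alpha>' \<gamma> \<gamma>'" "matched \<gamma> \<gamma>' \<beta> \<beta>'"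
proof -
  let ?A = "{\<gamma>\<^sub>1 \<in> \<Omega>. X.R \<alpha> \<gamma>\<^sub>1 = X.R \<alpha> \<gamma> \<and> X.R \<gamma>\<^sub>1 \<beta> = X.R \<gamma> \<beta>}"
  let ?A' = "{\<gamma>' \<in> \<Omega>'. X'.R \<alpha>' \<gamma>' = \<phi> (X.R \<alpha> \<gamma>) \<and> X'.R \<gamma>' \<beta>' = \<phi> (X.R \<gamma> \<beta>)}"
  have "card ?A > 0" using assms X.finite_points by (auto simp: card_gt_0_iff)
  then have "card ?A' > 0" using card_matched[OF assms(1-5)] assms X.basis_relation_of by simp
  then have "?A' \<noteq> {}" by fastforce
  then show ?thesis using that unfolding matched_def by fastforce
qed

lemma pull:
  assumes "\<alpha> \<in> \<Omega>" "\<beta> \<in> \<Omega>" "\<alpha>' \<in> \<Omega>'" "\<beta>' \<in> \<Omega>'" "matched \<alpha> \<alpha>' \<beta> \<beta>'" "\<gamma>' \<in> \<Omega>'"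
  obtains \<gamma> where "\<gamma> \<in> \<Omega>" "matched \<alpha> \<alpha>' \<gamma> \<gamma>'" "matched \<gamma> \<gamma>' \<beta> \<beta>'"
proof -
  obtain r s where rs: "r \<in> S" "s \<in> S" "\<phi> r = X'.R \<alpha>' \<gamma>'" "\<phi> s = X'.R \<gamma>' \<beta>'"
    using preimage assms by metis
  let ?A = "{\<gamma> \<in> \<Omega>. X.R \<alpha> \<gamma> = r \<and> X.R \<gamma> \<beta> = s}"
  let ?A' = "{\<gamma>\<^sub>1 \<in> \<Omega>'. X'.R \<alpha>' \<gamma>\<^sub>1 = \<phi> r \<and> X'.R \<gamma>\<^sub>1 \<beta>' = \<phi> s}"
  have "card ?A' > 0" using assms X'.finite_points rs by (auto simp: card_gt_0_iff)
  then have "card ?A > 0" using card_matched[OF assms(1-5)] rs by simp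
  then have "?A \<noteq> {}" by fastforce
  then show ?thesis using that rs unfolding matched_def by fastforce
qed

text \<open>Diagonal colours go to diagonal colours: pulling \<open>\<beta>'\<close> back over the
  loop at \<open>\<alpha>\<close> can only give \<open>\<alpha>\<close>, so
  \<open>(\<alpha>', \<beta>')\<close> and \<open>(\<beta>', \<beta>')\<close> have the same
  colour.\<close>

lemma matched_refl:
  assumes "\<alpha> \<in> \<Omega>" "\<alpha>' \<in> \<Omega>'" "\<beta>' \<in> \<Omega>'" "matched \<alpha> \<alpha>' \<alpha> \<beta>'"
  shows "\<alpha>' = \<beta>'"
proof -
  obtain \<gamma> where \<gamma>: "\<gamma> \<in> \<Omega>" "matched \<alpha> \<alpha>' \<gamma> \<beta>'" "matched \<gamma> \<beta>' \<alpha> \<beta>'"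
    using pull[OF assms(1,1,2,3,4,3)] by blast
  have "X.R \<alpha> \<gamma> = X.R \<alpha> \<alpha>"
    using \<gamma> assms image_eq_iff X.basis_relation_of unfolding matched_def by metis
  then have "\<alpha> = \<gamma>" using X.basis_relation_of_diagonal_eqD assms \<gamma> by metis
  with \<gamma> assms have "X'.R \<alpha>' \<beta>' = X'.R \<beta>' \<beta>'" unfolding matched_def by simp
  then show ?thesis using X'.basis_relation_of_diagonal_eqD assms by metis
qed

text \<open>This is compatibility of \<open>\<phi>\<close> with converses. Pushing
  \<open>\<beta>\<close> over the matched loop at \<open>\<alpha>\<close> gives an edge matched in
  both directions, and its colour is that of \<open>(\<alpha>', \<beta>')\<close>.\<close>

lemma matched_sym:
  assumes "\<alpha> \<in> \<Omega>" "\<beta> \<in> \<Omega>" "\<alpha>' \<in> \<Omega>'" "\<beta>' \<in> \<Omega>'" "matched \<alpha> \<alpha>' \<beta> \<beta>'"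
  shows "matched \<beta> \<beta>' \<alpha> \<alpha>'"
proof -
  obtain \<gamma>' where \<gamma>': "\<gamma>' \<in> \<Omega>'" "matched \<alpha> \<alpha>' \<alpha> \<gamma>'"
    using push[OF assms(1-5) assms(1)] by blast
  then have "matched \<alpha> \<alpha>' \<alpha> \<alpha>'" using matched_refl assms by metis
  then obtain \<beta>\<^sub>1 where \<beta>\<^sub>1: "\<beta>\<^sub>1 \<in> \<Omega>'" "matched \<alpha> \<alpha>' \<beta> \<beta>\<^sub>1" "matched \<beta> \<beta>\<^sub>1 \<alpha> \<alpha>'"
    using push[OF assms(1,1,3,3) _ assms(2)] by blast
  then have "X'.R \<alpha>' \<beta>\<^sub>1 = X'.R \<alpha>' \<beta>'" using assms unfolding matched_def by simp
  then have "X'.R \<beta>\<^sub>1 \<alpha>' = X'.R \<beta>' \<alpha>'"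
    using X'.basis_relation_of_converse[of \<alpha>'] \<beta>\<^sub>1(1) assms by metis
  with \<beta>\<^sub>1 show ?thesis unfolding matched_def by simp
qed

end

section \<open>Transport inside one configuration, and the count of rigid paths\<close>

context coherent_configuration
begin

text \<open>Taking the configuration as its own target makes the matching lemmas available for
  moving points within \<open>\<Omega>\<close>.\<close>

lemma identity_algebraic_isomorphism: "algebraically_isomorphic_configurations \<Omega> S \<Omega> S (\<lambda>s. s)"
  by unfold_locales (auto simp: algebraic_isomorphism_def bij_betw_def)

lemma transport:
  assumes "\<alpha> \<in> \<Omega>" "\<beta> \<in> \<Omega>" "\<alpha>\<^sub>1 \<in> \<Omega>" "\<beta>\<^sub>1 \<in> \<Omega>" "R \<alpha> \<beta> = R \<alpha>\<^sub>1 \<beta>\<^sub>1" "\<gamma> \<in> \<Omega>"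
  obtains \<gamma>\<^sub>1 where "\<gamma>\<^sub>1 \<in> \<Omega>" "R \<alpha>\<^sub>1 \<gamma>\<^sub>1 = R \<alpha> \<gamma>" "R \<gamma>\<^sub>1 \<beta>\<^sub>1 = R \<gamma> \<beta>"
  using algebraically_isomorphic_configurations.push[OF identity_algebraic_isomorphism assms(1-4) _ assms(6)] assms(5)
  unfolding algebraically_isomorphic_configurations.matched_def[OF identity_algebraic_isomorphism] by metis

lemma basis_relation_of_swap:
  assumes "\<alpha> \<in> \<Omega>" "\<beta> \<in> \<Omega>" "\<gamma> \<in> \<Omega>" "\<delta> \<in> \<Omega>" "R \<alpha> \<beta> = R \<gamma> \<delta>"
  shows "R \<beta> \<alpha> = R \<delta> \<gamma>"
  using basis_relation_of_converse assms by metis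

text \<open>
  If \<open>\<beta>\<^sub>1, \<gamma>\<^sub>1\<close> witness that \<open>\<beta>, \<gamma>, \<delta>\<close> is not rigid, then moving the triangle \<open>\<beta>\<^sub>1, \<gamma>\<^sub>1, \<delta>\<close> so that
  \<open>\<gamma>\<^sub>1\<close> goes to \<open>\<gamma>\<close> turns \<open>\<beta>\<^sub>1\<close> into a point \<open>\<beta>\<^sub>2 \<noteq> \<beta>\<close> which \<open>\<gamma>\<close> does not distinguish from \<open>\<beta>\<close>.
\<close>

lemma card_not_rigid_le:
  assumes "\<mu> \<in> \<Omega>" "\<beta> \<in> \<Omega>" "\<delta> \<in> \<Omega>"
  shows "card {\<gamma> \<in> \<Omega>. \<not> rigid \<mu> \<beta> \<gamma> \<delta>}
    \<le> indistinguishing_number \<Omega> S * (maximal_valency S - 1) * maximal_valency S"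
proof -
  let ?k = "maximal_valency S" and ?c = "indistinguishing_number \<Omega> S"
  let ?B = "orbit \<mu> \<beta> - {\<beta>}"
  let ?D = "\<lambda>\<beta>\<^sub>1. {\<beta>\<^sub>2 \<in> \<Omega>. R \<beta>\<^sub>2 \<delta> = R \<beta>\<^sub>1 \<delta>} - {\<beta>}"
  let ?C = "\<lambda>\<beta>\<^sub>2. {\<gamma> \<in> \<Omega>. R \<gamma> \<beta>\<^sub>2 = R \<gamma> \<beta>}"
  \<comment> \<open>There are at most \<open>?k - 1\<close> choices of
    \<open>\<beta>\<^sub>1\<close>, then at most \<open>?k\<close> of
    \<open>\<beta>\<^sub>2\<close>, then at most \<open>?c\<close> of \<open>\<gamma>\<close>. Both
    \<open>\<beta>\<^sub>1\<close> and \<open>\<beta>\<^sub>2\<close> differ from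
    \<open>\<beta>\<close> because their colour to \<open>\<delta>\<close> does.\<close>
  have "{\<gamma> \<in> \<Omega>. \<not> rigid \<mu> \<beta> \<gamma> \<delta>} \<subseteq> (\<Union>\<beta>\<^sub>1\<in>?B. \<Union>\<beta>\<^sub>2\<in>?D \<beta>\<^sub>1. ?C \<beta>\<^sub>2)"
  proof
    fix \<gamma> assume "\<gamma> \<in> {\<gamma> \<in> \<Omega>. \<not> rigid \<mu> \<beta> \<gamma> \<delta>}"
    then obtain \<beta>\<^sub>1 \<gamma>\<^sub>1 where \<gamma>: "\<gamma> \<in> \<Omega>" and \<beta>\<^sub>1: "\<beta>\<^sub>1 \<in> orbit \<mu> \<beta>" and \<gamma>\<^sub>1: "\<gamma>\<^sub>1 \<in> \<Omega>"
      and eq: "R \<beta>\<^sub>1 \<gamma>\<^sub>1 = R \<beta> \<gamma>" "R \<gamma>\<^sub>1 \<delta> = R \<gamma> \<delta>" "R \<beta>\<^sub>1 \<delta> \<noteq> R \<beta> \<delta>"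
      unfolding rigid_def by auto
    have \<beta>\<^sub>1': "\<beta>\<^sub>1 \<in> \<Omega>" using \<beta>\<^sub>1 by (simp add: orbit_def)
    obtain \<beta>\<^sub>2 where \<beta>\<^sub>2: "\<beta>\<^sub>2 \<in> \<Omega>" "R \<gamma> \<beta>\<^sub>2 = R \<gamma>\<^sub>1 \<beta>\<^sub>1" "R \<beta>\<^sub>2 \<delta> = R \<beta>\<^sub>1 \<delta>"
      using transport[OF \<gamma>\<^sub>1 assms(3) \<gamma> assms(3) eq(2) \<beta>\<^sub>1'] by metis
    have "R \<gamma>\<^sub>1 \<beta>\<^sub>1 = R \<gamma> \<beta>" using basis_relation_of_swap eq(1) \<beta>\<^sub>1' \<gamma> \<gamma>\<^sub>1 assms by blast
    then show "\<gamma> \<in> (\<Union>\<beta>\<^sub>1\<in>?B. \<Union>\<beta>\<^sub>2\<in>?D \<beta>\<^sub>1. ?C \<beta>\<^sub>2)"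
      using \<beta>\<^sub>1 \<beta>\<^sub>2 \<gamma> eq(3) by (intro UN_I[of \<beta>\<^sub>1] UN_I[of \<beta>\<^sub>2]) auto
  qed
  then have "card {\<gamma> \<in> \<Omega>. \<not> rigid \<mu> \<beta> \<gamma> \<delta>} \<le> card (\<Union>\<beta>\<^sub>1\<in>?B. \<Union>\<beta>\<^sub>2\<in>?D \<beta>\<^sub>1. ?C \<beta>\<^sub>2)"
    using finite_points by (intro card_mono) auto
  also have "\<dots> \<le> (\<Sum>\<beta>\<^sub>1\<in>?B. card (\<Union>\<beta>\<^sub>2\<in>?D \<beta>\<^sub>1. ?C \<beta>\<^sub>2))" by (intro card_UN_le) simp
  also have "\<dots> \<le> (\<Sum>\<beta>\<^sub>1\<in>?B. ?k * ?c)"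
  proof (intro sum_mono)
    fix \<beta>\<^sub>1 assume "\<beta>\<^sub>1 \<in> ?B"
    then have \<beta>\<^sub>1: "\<beta>\<^sub>1 \<in> \<Omega>" by (simp add: orbit_def)
    have "card (\<Union>\<beta>\<^sub>2\<in>?D \<beta>\<^sub>1. ?C \<beta>\<^sub>2) \<le> (\<Sum>\<beta>\<^sub>2\<in>?D \<beta>\<^sub>1. card (?C \<beta>\<^sub>2))"
      using finite_points by (intro card_UN_le) simp
    also have "\<dots> \<le> card (?D \<beta>\<^sub>1) * ?c"
      using card_indistinguishing_le assms
      by (intro sum_bounded_above[where 'a = nat, simplified]) auto
    also have "card (?D \<beta>\<^sub>1) \<le> card {\<beta>\<^sub>2 \<in> \<Omega>. R \<beta>\<^sub>2 \<delta> = R \<beta>\<^sub>1 \<delta>}"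
      using finite_points by (intro card_mono) auto
    also have "\<dots> \<le> ?k" using card_in_neighbours_le assms(3) basis_relation_of \<beta>\<^sub>1 by simp
    finally show "card (\<Union>\<beta>\<^sub>2\<in>?D \<beta>\<^sub>1. ?C \<beta>\<^sub>2) \<le> ?k * ?c" by simp
  qed
  also have "\<dots> = card ?B * (?k * ?c)" by simp
  also have "\<dots> \<le> (?k - 1) * (?k * ?c)"
  proof -
    have "\<beta> \<in> orbit \<mu> \<beta>" using assms by (simp add: orbit_def)
    then have "card ?B = card (orbit \<mu> \<beta>) - 1" by simp
    then show ?thesis
      using card_out_neighbours_le[of \<mu> "R \<mu> \<beta>"] assms basis_relation_of
      unfolding orbit_def by (intro mult_right_mono) auto
  qed
  finally show ?thesis by (simp add: ac_simps)
qed

text \<open>Rigidity with \<open>\<epsilon>\<close> itself as the middle point shows that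
  \<open>\<gamma>\<close> cannot separate what \<open>\<epsilon>\<close> does not separate from
  \<open>\<beta>\<close> in its orbit.\<close>

lemma rigid_determines:
  assumes "\<beta> \<in> \<Omega>" "\<gamma> \<in> \<Omega>" "\<epsilon> \<in> \<Omega>" "rigid \<mu> \<beta> \<epsilon> \<gamma>" "determines \<mu> \<gamma> \<beta>"
  shows "determines \<mu> \<epsilon> \<beta>"
  unfolding determines_def
proof (intro ballI impI)
  fix \<beta>\<^sub>1 assume \<beta>\<^sub>1: "\<beta>\<^sub>1 \<in> orbit \<mu> \<beta>" "R \<epsilon> \<beta>\<^sub>1 = R \<epsilon> \<beta>"
  then have \<beta>\<^sub>1': "\<beta>\<^sub>1 \<in> \<Omega>" by (simp add: orbit_def)
  have "R \<beta>\<^sub>1 \<epsilon> = R \<beta> \<epsilon>" by (rule basis_relation_of_swap[OF assms(3) \<beta>\<^sub>1' assms(3,1) \<beta>\<^sub>1(2)])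
  then have "R \<beta>\<^sub>1 \<gamma> = R \<beta> \<gamma>" using assms(3,4) \<beta>\<^sub>1(1) unfolding rigid_def by simp
  then have "R \<gamma> \<beta>\<^sub>1 = R \<gamma> \<beta>" by (rule basis_relation_of_swap[OF \<beta>\<^sub>1' assms(2,1,2)])
  then show "\<beta>\<^sub>1 = \<beta>" using assms(5) \<beta>\<^sub>1(1) unfolding determines_def by simp
qed

end

section \<open>Consequences of determination and rigidity in the target\<close>

context algebraically_isomorphic_configurations
begin

text \<open>The candidates for the image of \<open>\<gamma>\<close> are as many as the points of
  \<open>\<Omega>\<close> with the colours of \<open>\<gamma>\<close>, and determination leaves only
  \<open>\<gamma>\<close>.\<close>

lemma matched_unique:
  assumes "\<mu> \<in> \<Omega>" "\<beta> \<in> \<Omega>" "\<mu>' \<in> \<Omega>'" "\<beta>' \<in> \<Omega>'" "matched \<mu> \<mu>' \<beta> \<beta>'" "\<gamma> \<in> \<Omega>"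
    and "X.determines \<mu> \<beta> \<gamma>"
    and "\<gamma>\<^sub>1 \<in> \<Omega>'" "matched \<mu> \<mu>' \<gamma> \<gamma>\<^sub>1" "matched \<beta> \<beta>' \<gamma> \<gamma>\<^sub>1"
    and "\<gamma>\<^sub>2 \<in> \<Omega>'" "matched \<mu> \<mu>' \<gamma> \<gamma>\<^sub>2" "matched \<beta> \<beta>' \<gamma> \<gamma>\<^sub>2"
  shows "\<gamma>\<^sub>1 = \<gamma>\<^sub>2"
proof -
  let ?A = "{\<gamma>\<^sub>1 \<in> \<Omega>. X.R \<mu> \<gamma>\<^sub>1 = X.R \<mu> \<gamma> \<and> X.R \<gamma>\<^sub>1 \<beta> = X.R \<gamma> \<beta>}"
  let ?A' = "{\<gamma>' \<in> \<Omega>'. X'.R \<mu>' \<gamma>' = \<phi> (X.R \<mu> \<gamma>) \<and> X'.R \<gamma>' \<beta>' = \<phi> (X.R \<gamma> \<beta>)}"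
  have "\<gamma>\<^sub>1 = \<gamma>" if "\<gamma>\<^sub>1 \<in> ?A" for \<gamma>\<^sub>1
  proof -
    have "X.R \<beta> \<gamma>\<^sub>1 = X.R \<beta> \<gamma>"
      using that X.basis_relation_of_swap[of \<gamma>\<^sub>1 \<beta> \<gamma> \<beta>] assms(2,6) by simp
    then show ?thesis using that assms(7) unfolding X.determines_def X.orbit_def by simp
  qed
  then have "?A = {\<gamma>}" using assms(6) by blast
  moreover have "card ?A = card ?A'"
    using assms(1,2,6) X.basis_relation_of(1) by (intro card_matched[OF assms(1-5)])
  ultimately have "card ?A' = 1" by simp
  then obtain x where "?A' = {x}" by (auto simp: card_1_singleton_iff)
  moreover have "\<gamma>\<^sub>1 \<in> ?A'" "\<gamma>\<^sub>2 \<in> ?A'"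
    using assms(8,9,11,12) matched_sym[OF assms(2,6,4,8,10)] matched_sym[OF assms(2,6,4,11,13)]
    unfolding matched_def by auto
  ultimately show ?thesis by (metis (no_types, lifting) singletonD)
qed

text \<open>Pulling back \<open>\<beta>'\<close> over \<open>\<mu>\<delta>\<close>, and then
  \<open>\<gamma>'\<close> over the edge obtained, reproduces the image triangle in
  \<open>\<Omega>\<close>, where rigidity fixes the colour of its third side.\<close>

lemma matched_rigid:
  assumes "\<mu> \<in> \<Omega>" "\<beta> \<in> \<Omega>" "\<gamma> \<in> \<Omega>" "\<delta> \<in> \<Omega>" "\<mu>' \<in> \<Omega>'" "\<beta>' \<in> \<Omega>'" "\<gamma>' \<in> \<Omega>'" "\<delta>' \<in> \<Omega>'"
    and "matched \<mu> \<mu>' \<beta> \<beta>'" "matched \<mu> \<mu>' \<delta> \<delta>'" "matched \<beta> \<beta>' \<gamma> \<gamma>'" "matched \<gamma> \<gamma>' \<delta> \<delta>'"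
    and "X.rigid \<mu> \<beta> \<gamma> \<delta>"
  shows "matched \<beta> \<beta>' \<delta> \<delta>'"
proof -
  obtain \<beta>\<^sub>1 where \<beta>\<^sub>1: "\<beta>\<^sub>1 \<in> \<Omega>" "matched \<mu> \<mu>' \<beta>\<^sub>1 \<beta>'" "matched \<beta>\<^sub>1 \<beta>' \<delta> \<delta>'"
    using pull[OF assms(1,4,5,8,10,6)] by metis
  obtain \<gamma>\<^sub>1 where \<gamma>\<^sub>1: "\<gamma>\<^sub>1 \<in> \<Omega>" "matched \<beta>\<^sub>1 \<beta>' \<gamma>\<^sub>1 \<gamma>'" "matched \<gamma>\<^sub>1 \<gamma>' \<delta> \<delta>'"
    using pull[OF \<beta>\<^sub>1(1) assms(4,6,8) \<beta>\<^sub>1(3) assms(7)] by metis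
  have "X.R \<mu> \<beta>\<^sub>1 = X.R \<mu> \<beta>" "X.R \<beta>\<^sub>1 \<gamma>\<^sub>1 = X.R \<beta> \<gamma>" "X.R \<gamma>\<^sub>1 \<delta> = X.R \<gamma> \<delta>"
    using \<beta>\<^sub>1 \<gamma>\<^sub>1 assms image_eq_iff X.basis_relation_of unfolding matched_def by metis+
  then have "X.R \<beta>\<^sub>1 \<delta> = X.R \<beta> \<delta>"
    using assms(13) \<beta>\<^sub>1(1) \<gamma>\<^sub>1(1) unfolding X.rigid_def X.orbit_def by blast
  then show ?thesis using \<beta>\<^sub>1(3) unfolding matched_def by simp
qed

end

text \<open>
  Determination defines a surjection from the orbit of the determining point onto that of the
  determined one; if the latter orbit has maximal size, the surjection is a bijection.
\<close>

lemma (in coherent_configuration) determines_commute: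
  assumes "\<mu> \<in> \<Omega>" "\<beta> \<in> \<Omega>" "\<gamma> \<in> \<Omega>" "determines \<mu> \<gamma> \<beta>"
    and max: "\<And>\<delta>. \<delta> \<in> \<Omega> \<Longrightarrow> card (orbit \<mu> \<delta>) \<le> card (orbit \<mu> \<beta>)"
  shows "determines \<mu> \<beta> \<gamma>" "card (orbit \<mu> \<gamma>) = card (orbit \<mu> \<beta>)"
proof -
  \<comment> \<open>Uniqueness of images for the identity isomorphism carries determination from
    \<open>\<gamma>\<close> to every point of its orbit.\<close>
  have unique: "b = b'"
    if "\<gamma>\<^sub>1 \<in> orbit \<mu> \<gamma>" "b \<in> orbit \<mu> \<beta>" "b' \<in> orbit \<mu> \<beta>"
      "R \<gamma>\<^sub>1 b = R \<gamma> \<beta>" "R \<gamma>\<^sub>1 b' = R \<gamma> \<beta>" for \<gamma>\<^sub>1 b b'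
    using that assms(1-4)
    by (intro algebraically_isomorphic_configurations.matched_unique[OF identity_algebraic_isomorphism,
          of \<mu> \<gamma> \<mu> \<gamma>\<^sub>1 \<beta> b b'])
      (simp_all add: algebraically_isomorphic_configurations.matched_def[OF identity_algebraic_isomorphism] orbit_def)
  have "\<exists>b. b \<in> orbit \<mu> \<beta> \<and> R \<gamma>\<^sub>1 b = R \<gamma> \<beta>" if "\<gamma>\<^sub>1 \<in> orbit \<mu> \<gamma>" for \<gamma>\<^sub>1
  proof -
    have "\<gamma>\<^sub>1 \<in> \<Omega>" "R \<mu> \<gamma> = R \<mu> \<gamma>\<^sub>1" using that by (simp_all add: orbit_def)
    then obtain b where b: "b \<in> \<Omega>" "R \<mu> b = R \<mu> \<beta>" "R b \<gamma>\<^sub>1 = R \<beta> \<gamma>"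
      using transport[of \<mu> \<gamma> \<mu> \<gamma>\<^sub>1 \<beta>] assms(1-3) by metis
    have "R \<gamma>\<^sub>1 b = R \<gamma> \<beta>" by (rule basis_relation_of_swap) (use b \<open>\<gamma>\<^sub>1 \<in> \<Omega>\<close> assms in simp_all)
    with b show ?thesis by (auto simp: orbit_def)
  qed
  then obtain g where g: "\<And>\<gamma>\<^sub>1. \<gamma>\<^sub>1 \<in> orbit \<mu> \<gamma> \<Longrightarrow> g \<gamma>\<^sub>1 \<in> orbit \<mu> \<beta> \<and> R \<gamma>\<^sub>1 (g \<gamma>\<^sub>1) = R \<gamma> \<beta>"
    by metis
  have "g ` orbit \<mu> \<gamma> = orbit \<mu> \<beta>"
  proof
    show "orbit \<mu> \<beta> \<subseteq> g ` orbit \<mu> \<gamma>"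
    proof
      fix b assume b: "b \<in> orbit \<mu> \<beta>"
      then have "b \<in> \<Omega>" "R \<mu> \<beta> = R \<mu> b" by (simp_all add: orbit_def)
      then obtain \<gamma>\<^sub>1 where \<gamma>\<^sub>1: "\<gamma>\<^sub>1 \<in> \<Omega>" "R \<mu> \<gamma>\<^sub>1 = R \<mu> \<gamma>" "R \<gamma>\<^sub>1 b = R \<gamma> \<beta>"
        using transport[of \<mu> \<beta> \<mu> b \<gamma>] assms(1-3) by metis
      then have "\<gamma>\<^sub>1 \<in> orbit \<mu> \<gamma>" by (simp add: orbit_def)
      moreover have "g \<gamma>\<^sub>1 = b" using unique g b \<gamma>\<^sub>1(3) calculation by blast
      ultimately show "b \<in> g ` orbit \<mu> \<gamma>" by blast
    qed
  qed (use g in blast)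
  moreover have "card (g ` orbit \<mu> \<gamma>) \<le> card (orbit \<mu> \<gamma>)" by (rule card_image_le) simp
  ultimately show card: "card (orbit \<mu> \<gamma>) = card (orbit \<mu> \<beta>)" using max[OF assms(3)] by simp
  have inj: "inj_on g (orbit \<mu> \<gamma>)"
    using \<open>g ` orbit \<mu> \<gamma> = orbit \<mu> \<beta>\<close> card by (intro eq_card_imp_inj_on) simp_all
  have self_mem: "\<beta> \<in> orbit \<mu> \<beta>" "\<gamma> \<in> orbit \<mu> \<gamma>" using assms by (simp_all add: orbit_def)
  show "determines \<mu> \<beta> \<gamma>"
    unfolding determines_def
  proof (intro ballI impI)
    fix \<gamma>\<^sub>1 assume \<gamma>\<^sub>1: "\<gamma>\<^sub>1 \<in> orbit \<mu> \<gamma>" "R \<beta> \<gamma>\<^sub>1 = R \<beta> \<gamma>"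
    then have "\<gamma>\<^sub>1 \<in> \<Omega>" by (simp add: orbit_def)
    then have "R \<gamma>\<^sub>1 \<beta> = R \<gamma> \<beta>" using basis_relation_of_swap[OF _ _ _ _ \<gamma>\<^sub>1(2)] assms(2,3) by simp
    then have "g \<gamma>\<^sub>1 = \<beta>" "g \<gamma> = \<beta>" using unique g self_mem \<gamma>\<^sub>1(1) by blast+
    then show "\<gamma>\<^sub>1 = \<gamma>" using inj \<gamma>\<^sub>1(1) self_mem(2) by (metis inj_onD)
  qed
qed

text \<open>This is the union bound. With a list, the sum unfolds into explicit terms, and
  coinciding predicates need no case distinction.\<close>

lemma exists_common_good:
  assumes "finite A" "(\<Sum>P\<leftarrow>Ps. card {x \<in> A. \<not> P x}) < card A"
  obtains x where "x \<in> A" "\<And>P. P \<in> set Ps \<Longrightarrow> P x"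
proof -
  have "card {x \<in> A. \<exists>P \<in> set Ps. \<not> P x} \<le> (\<Sum>P\<leftarrow>Ps. card {x \<in> A. \<not> P x})"
  proof (induction Ps)
    case (Cons Q Ps)
    have "{x \<in> A. \<exists>P \<in> set (Q # Ps). \<not> P x} = {x \<in> A. \<not> Q x} \<union> {x \<in> A. \<exists>P \<in> set Ps. \<not> P x}"
      by auto
    then show ?case using Cons card_Un_le[of "{x \<in> A. \<not> Q x}" "{x \<in> A. \<exists>P \<in> set Ps. \<not> P x}"]
      by simp
  qed simp
  then have "{x \<in> A. \<exists>P \<in> set Ps. \<not> P x} \<noteq> A" using assms(2) by auto
  then show ?thesis using that by blast
qed

section \<open>Propagating images from a base point under the size hypothesis\<close>

locale pointed_large_configuration = algebraically_isomorphic_configurations +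
  fixes \<mu> \<mu>'
  assumes base: "\<mu> \<in> \<Omega>" "\<mu>' \<in> \<Omega>'" "matched \<mu> \<mu>' \<mu> \<mu>'"
    and large: "card \<Omega> >
      3 * indistinguishing_number \<Omega> S * (maximal_valency S - 1) * maximal_valency S"
begin

abbreviation determines :: "'a \<Rightarrow> 'a \<Rightarrow> bool" where
  "determines \<equiv> X.determines \<mu>"

abbreviation rigid :: "'a \<Rightarrow> 'a \<Rightarrow> 'a \<Rightarrow> bool" where
  "rigid \<equiv> X.rigid \<mu>"

definition maximal :: "'a \<Rightarrow> bool" where
  "maximal \<beta> \<longleftrightarrow> \<beta> \<in> \<Omega> \<and> (\<forall>\<delta>\<in>\<Omega>. card (X.orbit \<mu> \<delta>) \<le> card (X.orbit \<mu> \<beta>))"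

text \<open>In the covering picture the points \<open>\<alpha>'\<close> form the fibre over
  \<open>\<alpha>\<close>; \<open>lift\<close> and \<open>lift_unique\<close> are existence and
  uniqueness of lifts of an edge.\<close>

definition corresponds :: "'a \<Rightarrow> 'b \<Rightarrow> bool" where
  "corresponds \<alpha> \<alpha>' \<longleftrightarrow> \<alpha> \<in> \<Omega> \<and> \<alpha>' \<in> \<Omega>' \<and> matched \<mu> \<mu>' \<alpha> \<alpha>'"

lemma lift:
  assumes "corresponds \<beta> \<beta>'" "\<gamma> \<in> \<Omega>"
  obtains \<gamma>' where "corresponds \<gamma> \<gamma>'" "matched \<beta> \<beta>' \<gamma> \<gamma>'"
  using assms base push[of \<mu> \<beta> \<mu>' \<beta>' \<gamma>] matched_sym[of \<gamma> \<beta> _ \<beta>']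
  unfolding corresponds_def by metis

lemma matched_commute:
  assumes "corresponds \<alpha> \<alpha>'" "corresponds \<beta> \<beta>'" "matched \<alpha> \<alpha>' \<beta> \<beta>'"
  shows "matched \<beta> \<beta>' \<alpha> \<alpha>'"
  using assms matched_sym unfolding corresponds_def by metis

lemma lift_unique:
  assumes "corresponds \<beta> \<beta>'" "determines \<beta> \<gamma>" "corresponds \<gamma> \<gamma>\<^sub>1" "corresponds \<gamma> \<gamma>\<^sub>2"
    "matched \<beta> \<beta>' \<gamma> \<gamma>\<^sub>1" "matched \<beta> \<beta>' \<gamma> \<gamma>\<^sub>2"
  shows "\<gamma>\<^sub>1 = \<gamma>\<^sub>2"
  using assms base by (intro matched_unique[of \<mu> \<beta> \<mu>' \<beta>' \<gamma>]) (auto simp: corresponds_def)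

lemma rigid_matched:
  assumes "rigid \<beta> \<gamma> \<delta>" "corresponds \<beta> \<beta>'" "corresponds \<gamma> \<gamma>'" "corresponds \<delta> \<delta>'"
    "matched \<beta> \<beta>' \<gamma> \<gamma>'" "matched \<gamma> \<gamma>' \<delta> \<delta>'"
  shows "matched \<beta> \<beta>' \<delta> \<delta>'"
  using assms base by (intro matched_rigid[of \<mu> \<beta> \<gamma> \<delta> \<mu>' \<beta>' \<gamma>' \<delta>']) (auto simp: corresponds_def)

lemma maximal_determines:
  assumes "maximal \<beta>" "\<gamma> \<in> \<Omega>" "determines \<gamma> \<beta>"
  shows "determines \<beta> \<gamma>" "maximal \<gamma>"
  using assms base X.determines_commute[of \<mu> \<beta> \<gamma>] unfolding maximal_def by auto

lemma exists_maximal: obtains \<beta> where "maximal \<beta>"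
proof -
  let ?M = "(\<lambda>\<delta>. card (X.orbit \<mu> \<delta>)) ` \<Omega>"
  have "Max ?M \<in> ?M" using X.finite_points base by (intro Max_in) auto
  then obtain \<beta> where "\<beta> \<in> \<Omega>" "Max ?M = card (X.orbit \<mu> \<beta>)" by auto
  moreover have "card (X.orbit \<mu> \<delta>) \<le> Max ?M" if "\<delta> \<in> \<Omega>" for \<delta>
    using that X.finite_points by simp
  ultimately show ?thesis using that unfolding maximal_def by metis
qed

text \<open>Here \<open>d\<close> bounds the points that do not determine a given one, and
  \<open>d * maximal_valency S\<close> the midpoints of non-rigid paths between given ends. The
  inequalities serve the union bounds to come.\<close>

lemma large_sums:
  defines "d \<equiv> indistinguishing_number \<Omega> S * (maximal_valency S - 1)"
  shows "4 * d < card \<Omega>" "d + d * maximal_valency S < card \<Omega>" "3 * (d * maximal_valency S) < card \<Omega>"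
proof -
  let ?k = "maximal_valency S"
  show *: "3 * (d * ?k) < card \<Omega>" using large unfolding d_def by (simp add: mult.assoc)
  have k: "?k > 0" using X.maximal_valency_pos base by blast
  then have "d \<le> d * ?k" by simp
  with * show "d + d * ?k < card \<Omega>" by linarith
  show "4 * d < card \<Omega>"
  \<comment> \<open>Valency 1 gives \<open>d = 0\<close>, so only a nonempty \<open>\<Omega>\<close>
    is needed; otherwise \<open>2 * d\<close> is at most \<open>d * ?k\<close>.\<close>
  proof (cases "?k = 1")
    case False
    then have "d * 2 \<le> d * ?k" using k by (intro mult_left_mono) auto
    with * show ?thesis by linarith
  qed (use * in \<open>simp add: d_def\<close>)
qed

text \<open>A cone with apex \<open>\<epsilon>\<close> is lifted from \<open>\<beta>'\<close>. Two
  rigid faces and uniqueness of lifts show that its edges end at \<open>\<gamma>'\<close> and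
  \<open>\<delta>'\<close>; the third face then closes the base.\<close>

lemma close_triangle:
  assumes "maximal \<beta>" "determines \<gamma> \<beta>" "determines \<gamma> \<delta>"
    and corr: "corresponds \<beta> \<beta>'" "corresponds \<gamma> \<gamma>'" "corresponds \<delta> \<delta>'"
    and "matched \<beta> \<beta>' \<gamma> \<gamma>'" "matched \<gamma> \<gamma>' \<delta> \<delta>'"
  shows "matched \<beta> \<beta>' \<delta> \<delta>'"
proof -
  have \<Omega>: "\<beta> \<in> \<Omega>" "\<gamma> \<in> \<Omega>" "\<delta> \<in> \<Omega>" using corr by (auto simp: corresponds_def)
  have "(\<Sum>P\<leftarrow>[\<lambda>\<epsilon>. rigid \<beta> \<epsilon> \<gamma>, \<lambda>\<epsilon>. rigid \<delta> \<epsilon> \<gamma>, \<lambda>\<epsilon>. rigid \<delta> \<epsilon> \<beta>]. card {\<epsilon> \<in> \<Omega>. \<not> P \<epsilon>}) < card \<Omega>"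
    using large_sums(3) X.card_not_rigid_le[OF base(1) \<Omega>(1,2)]
      X.card_not_rigid_le[OF base(1) \<Omega>(3,2)] X.card_not_rigid_le[OF base(1) \<Omega>(3,1)] by simp
  then obtain \<epsilon> where \<epsilon>: "\<epsilon> \<in> \<Omega>" and rigid: "rigid \<beta> \<epsilon> \<gamma>" "rigid \<delta> \<epsilon> \<gamma>" "rigid \<delta> \<epsilon> \<beta>"
    by (rule exists_common_good[OF X.finite_points]) auto
  \<comment> \<open>Maximality reverses the determination, which makes the image of
    \<open>\<gamma>\<close> unique as seen from \<open>\<beta>\<close>.\<close>
  have "determines \<beta> \<gamma>" using maximal_determines assms(1,2) \<Omega> by blast
  obtain \<epsilon>' where \<epsilon>': "corresponds \<epsilon> \<epsilon>'" "matched \<beta> \<beta>' \<epsilon> \<epsilon>'" using lift[OF corr(1) \<epsilon>] .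
  obtain \<gamma>\<^sub>1 where \<gamma>\<^sub>1: "corresponds \<gamma> \<gamma>\<^sub>1" "matched \<epsilon> \<epsilon>' \<gamma> \<gamma>\<^sub>1" using lift[OF \<epsilon>'(1) \<Omega>(2)] .
  have "matched \<beta> \<beta>' \<gamma> \<gamma>\<^sub>1" using rigid_matched[OF rigid(1) corr(1) \<epsilon>'(1) \<gamma>\<^sub>1(1) \<epsilon>'(2) \<gamma>\<^sub>1(2)] .
  then have "\<gamma>\<^sub>1 = \<gamma>'"
    using lift_unique[OF corr(1) \<open>determines \<beta> \<gamma>\<close> \<gamma>\<^sub>1(1) corr(2)] assms by blast
  then have \<epsilon>\<gamma>: "matched \<epsilon> \<epsilon>' \<gamma> \<gamma>'" using \<gamma>\<^sub>1 by simp
  obtain \<delta>\<^sub>1 where \<delta>\<^sub>1: "corresponds \<delta> \<delta>\<^sub>1" "matched \<epsilon> \<epsilon>' \<delta> \<delta>\<^sub>1" using lift[OF \<epsilon>'(1) \<Omega>(3)] .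
  then have \<delta>\<epsilon>: "matched \<delta> \<delta>\<^sub>1 \<epsilon> \<epsilon>'" using matched_commute \<epsilon>' by blast
  then have "matched \<delta> \<delta>\<^sub>1 \<gamma> \<gamma>'" using rigid_matched[OF rigid(2) \<delta>\<^sub>1(1) \<epsilon>'(1) corr(2)] \<epsilon>\<gamma> by blast
  then have "matched \<gamma> \<gamma>' \<delta> \<delta>\<^sub>1" using matched_commute \<delta>\<^sub>1 corr by blast
  then have "\<delta>\<^sub>1 = \<delta>'" using lift_unique[OF corr(2) assms(3) \<delta>\<^sub>1(1) corr(3)] assms by blast
  then have "matched \<delta> \<delta>' \<beta> \<beta>'"
    using rigid_matched[OF rigid(3) corr(3) \<epsilon>'(1) corr(1)] \<delta>\<epsilon> matched_commute corr \<epsilon>' by blast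
  then show ?thesis using matched_commute corr by blast
qed

text \<open>Images spread from a maximal \<open>\<beta>\<close> to the points that determine it, and
  from these to every point of \<open>\<Omega>\<close>. Closing four-cycles makes the second stage
  independent of the intermediate point.\<close>

lemma exists_matched_map:
  obtains f where "\<And>\<omega>. \<omega> \<in> \<Omega> \<Longrightarrow> corresponds \<omega> (f \<omega>)"
    "\<And>\<omega>\<^sub>1 \<omega>\<^sub>2. \<omega>\<^sub>1 \<in> \<Omega> \<Longrightarrow> \<omega>\<^sub>2 \<in> \<Omega> \<Longrightarrow> matched \<omega>\<^sub>1 (f \<omega>\<^sub>1) \<omega>\<^sub>2 (f \<omega>\<^sub>2)"
proof -
  obtain \<beta> where \<beta>: "maximal \<beta>" using exists_maximal .
  then have \<beta>\<Omega>: "\<beta> \<in> \<Omega>" by (simp add: maximal_def)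
  have "corresponds \<mu> \<mu>'" using base by (simp add: corresponds_def)
  then obtain \<beta>' where \<beta>': "corresponds \<beta> \<beta>'" using lift \<beta>\<Omega> by blast
  \<comment> \<open>The image \<open>\<beta>'\<close> is chosen freely in the fibre and then kept;
    \<open>linked\<close> collects the resulting lifts of the points that determine
    \<open>\<beta>\<close>.\<close>
  define linked where
    "linked \<gamma> \<gamma>' \<longleftrightarrow> corresponds \<gamma> \<gamma>' \<and> determines \<gamma> \<beta> \<and> matched \<beta> \<beta>' \<gamma> \<gamma>'" for \<gamma> \<gamma>'
  have linkedD: "corresponds \<gamma> \<gamma>'" "maximal \<gamma>" "determines \<gamma> \<beta>" "determines \<beta> \<gamma>"
      "matched \<beta> \<beta>' \<gamma> \<gamma>'" "matched \<gamma> \<gamma>' \<beta> \<beta>'" "\<gamma> \<in> \<Omega>" if "linked \<gamma> \<gamma>'" for \<gamma> \<gamma>'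
    using that maximal_determines[OF \<beta>, of \<gamma>] matched_commute[OF \<beta>', of \<gamma> \<gamma>']
    unfolding linked_def corresponds_def by auto
  have linked_lift: "\<exists>\<gamma>'. linked \<gamma> \<gamma>'" if "\<gamma> \<in> \<Omega>" "determines \<gamma> \<beta>" for \<gamma>
    using lift[OF \<beta>' that(1)] that(2) unfolding linked_def by metis
  have linked_matched: "matched \<gamma> \<gamma>' \<epsilon> \<epsilon>'" if "linked \<gamma> \<gamma>'" "linked \<epsilon> \<epsilon>'" for \<gamma> \<gamma>' \<epsilon> \<epsilon>'
    using close_triangle[OF linkedD(2,4)[OF that(1)] linkedD(4)[OF that(2)]
        linkedD(1)[OF that(1)] \<beta>' linkedD(1)[OF that(2)] linkedD(6)[OF that(1)]
        linkedD(5)[OF that(2)]] .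
  have "\<exists>\<omega>'. corresponds \<omega> \<omega>' \<and> (\<forall>\<epsilon> \<epsilon>'. linked \<epsilon> \<epsilon>' \<longrightarrow> matched \<epsilon> \<epsilon>' \<omega> \<omega>')"
    if \<omega>: "\<omega> \<in> \<Omega>" for \<omega>
  proof -
    have "(\<Sum>P\<leftarrow>[\<lambda>\<gamma>. determines \<gamma> \<beta>, \<lambda>\<gamma>. determines \<gamma> \<omega>]. card {\<gamma> \<in> \<Omega>. \<not> P \<gamma>}) < card \<Omega>"
      using large_sums(1) X.card_not_determines_le[OF base(1) \<beta>\<Omega>]
        X.card_not_determines_le[OF base(1) \<omega>] by simp
    then obtain \<gamma> where \<gamma>: "\<gamma> \<in> \<Omega>" "determines \<gamma> \<beta>" "determines \<gamma> \<omega>"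
      by (rule exists_common_good[OF X.finite_points]) auto
    obtain \<gamma>' where \<gamma>': "linked \<gamma> \<gamma>'" using linked_lift \<gamma> by blast
    obtain \<omega>' where \<omega>': "corresponds \<omega> \<omega>'" "matched \<gamma> \<gamma>' \<omega> \<omega>'"
      using lift[OF linkedD(1)[OF \<gamma>'] \<omega>] .
    have "matched \<epsilon> \<epsilon>' \<omega> \<omega>'" if \<epsilon>: "linked \<epsilon> \<epsilon>'" for \<epsilon> \<epsilon>'
    proof -
      \<comment> \<open>The cycle \<open>\<beta>, \<gamma>, \<omega>, \<epsilon>\<close> is coned
        off with \<open>\<eta>\<close>. The two triangles at \<open>\<beta>\<close> close by
        \<open>linked_matched\<close>; those on \<open>\<gamma>\<omega>\<close> and
        \<open>\<epsilon>\<omega>\<close> are closed in turn.\<close>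
      have "(\<Sum>P\<leftarrow>[\<lambda>\<eta>. determines \<eta> \<beta>, \<lambda>\<eta>. determines \<eta> \<gamma>, \<lambda>\<eta>. determines \<eta> \<epsilon>, \<lambda>\<eta>. determines \<eta> \<omega>].
          card {\<eta> \<in> \<Omega>. \<not> P \<eta>}) < card \<Omega>"
        using large_sums(1) X.card_not_determines_le[OF base(1) \<beta>\<Omega>]
          X.card_not_determines_le[OF base(1) \<gamma>(1)] X.card_not_determines_le[OF base(1) \<omega>]
          X.card_not_determines_le[OF base(1) linkedD(7)[OF \<epsilon>]] by simp
      then obtain \<eta> where \<eta>: "\<eta> \<in> \<Omega>" "determines \<eta> \<beta>" "determines \<eta> \<gamma>" "determines \<eta> \<epsilon>"
          "determines \<eta> \<omega>"
        by (rule exists_common_good[OF X.finite_points]) auto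
      obtain \<eta>' where \<eta>': "linked \<eta> \<eta>'" using linked_lift \<eta> by blast
      have "determines \<gamma> \<eta>" using maximal_determines linkedD(2)[OF \<gamma>'] \<eta> by blast
      have "matched \<eta> \<eta>' \<omega> \<omega>'"
        using close_triangle[OF linkedD(2)[OF \<eta>'] \<open>determines \<gamma> \<eta>\<close> \<gamma>(3) linkedD(1)[OF \<eta>']
            linkedD(1)[OF \<gamma>'] \<omega>'(1) linked_matched[OF \<eta>' \<gamma>'] \<omega>'(2)] .
      then show ?thesis
        using close_triangle[OF linkedD(2)[OF \<epsilon>] \<eta>(4,5) linkedD(1)[OF \<epsilon>] linkedD(1)[OF \<eta>']
            \<omega>'(1) linked_matched[OF \<epsilon> \<eta>']] by blast
    qed
    with \<omega>' show ?thesis by blast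
  qed
  then obtain f where f: "\<And>\<omega>. \<omega> \<in> \<Omega> \<Longrightarrow> corresponds \<omega> (f \<omega>)"
      "\<And>\<omega> \<epsilon> \<epsilon>'. \<omega> \<in> \<Omega> \<Longrightarrow> linked \<epsilon> \<epsilon>' \<Longrightarrow> matched \<epsilon> \<epsilon>' \<omega> (f \<omega>)"
    by metis
  have "matched \<omega>\<^sub>1 (f \<omega>\<^sub>1) \<omega>\<^sub>2 (f \<omega>\<^sub>2)" if \<omega>: "\<omega>\<^sub>1 \<in> \<Omega>" "\<omega>\<^sub>2 \<in> \<Omega>" for \<omega>\<^sub>1 \<omega>\<^sub>2
  proof -
    \<comment> \<open>A linked midpoint is matched with both ends by the choice of \<open>f\<close>,
      so rigidity of the path settles the remaining side.\<close>
    have "(\<Sum>P\<leftarrow>[\<lambda>\<epsilon>. determines \<epsilon> \<beta>, \<lambda>\<epsilon>. rigid \<omega>\<^sub>1 \<epsilon> \<omega>\<^sub>2]. card {\<epsilon> \<in> \<Omega>. \<not> P \<epsilon>}) < card \<Omega>"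
      using large_sums(2) X.card_not_determines_le[OF base(1) \<beta>\<Omega>]
        X.card_not_rigid_le[OF base(1) \<omega>] by simp
    then obtain \<epsilon> where \<epsilon>: "\<epsilon> \<in> \<Omega>" "determines \<epsilon> \<beta>" "rigid \<omega>\<^sub>1 \<epsilon> \<omega>\<^sub>2"
      by (rule exists_common_good[OF X.finite_points]) auto
    obtain \<epsilon>' where \<epsilon>': "linked \<epsilon> \<epsilon>'" using linked_lift \<epsilon> by blast
    have "matched \<omega>\<^sub>1 (f \<omega>\<^sub>1) \<epsilon> \<epsilon>'"
      by (rule matched_commute[OF linkedD(1)[OF \<epsilon>'] f(1)[OF \<omega>(1)] f(2)[OF \<omega>(1) \<epsilon>']])
    then show ?thesis
      using rigid_matched[OF \<epsilon>(3) f(1)[OF \<omega>(1)] linkedD(1)[OF \<epsilon>'] f(1)[OF \<omega>(2)]]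
        f(2)[OF \<omega>(2) \<epsilon>'] by blast
  qed
  with f(1) that show ?thesis by blast
qed

lemma exists_inducing_isomorphism:
  "\<exists>f. isomorphism \<Omega> S \<Omega>' S' f \<and> induced_by S \<phi> f \<and> f \<mu> = \<mu>'"
proof -
  obtain f where f: "\<And>\<omega>. \<omega> \<in> \<Omega> \<Longrightarrow> corresponds \<omega> (f \<omega>)"
    and matched: "\<And>\<alpha> \<beta>. \<alpha> \<in> \<Omega> \<Longrightarrow> \<beta> \<in> \<Omega> \<Longrightarrow> matched \<alpha> (f \<alpha>) \<beta> (f \<beta>)"
    using exists_matched_map by blast
  have f_in: "f \<omega> \<in> \<Omega>'" if "\<omega> \<in> \<Omega>" for \<omega> using f[OF that] by (simp add: corresponds_def)
  have "\<mu>' = f \<mu>"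
    using matched_refl[of \<mu> \<mu>' "f \<mu>"] f[OF base(1)] base by (simp add: corresponds_def)
  have inj: "inj_on f \<Omega>"
  proof (rule inj_onI)
    fix \<alpha> \<beta> assume \<alpha>\<beta>: "\<alpha> \<in> \<Omega>" "\<beta> \<in> \<Omega>" "f \<alpha> = f \<beta>"
    then have "\<phi> (X.R \<alpha> \<beta>) = \<phi> (X.R \<alpha> \<alpha>)"
      using matched[of \<alpha> \<beta>] matched[of \<alpha> \<alpha>] unfolding matched_def by simp
    then have "X.R \<alpha> \<beta> = X.R \<alpha> \<alpha>"
      using image_eq_iff X.basis_relation_of(1) \<alpha>\<beta> by blast
    then show "\<alpha> = \<beta>" using X.basis_relation_of_diagonal_eqD \<alpha>\<beta> by blast
  qed
  have "\<omega>' \<in> f ` \<Omega>" if \<omega>': "\<omega>' \<in> \<Omega>'" for \<omega>'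
  proof -
    \<comment> \<open>Surjectivity is proved orbit by orbit: \<open>f\<close> injects the points
      coloured like \<open>\<gamma>\<close> relative to \<open>\<mu>\<close> into a set of the same
      size that contains \<open>\<omega>'\<close>.\<close>
    obtain \<gamma> where \<gamma>: "\<gamma> \<in> \<Omega>" "matched \<mu> \<mu>' \<gamma> \<omega>'" "matched \<gamma> \<omega>' \<mu> \<mu>'"
      using pull[OF base(1,1,2,2,3) \<omega>'] .
    let ?A = "{\<delta> \<in> \<Omega>. X.R \<mu> \<delta> = X.R \<mu> \<gamma> \<and> X.R \<delta> \<mu> = X.R \<gamma> \<mu>}"
    let ?A' = "{\<delta> \<in> \<Omega>'. X'.R \<mu>' \<delta> = \<phi> (X.R \<mu> \<gamma>) \<and> X'.R \<delta> \<mu>' = \<phi> (X.R \<gamma> \<mu>)}"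
    have "card ?A = card ?A'"
      using X.basis_relation_of(1) base(1) \<gamma>(1) by (intro card_matched[OF base(1,1,2,2,3)])
    moreover have "card (f ` ?A) = card ?A"
      by (intro card_image inj_on_subset[OF inj]) auto
    moreover have "f ` ?A \<subseteq> ?A'"
    proof
      fix \<delta>' assume "\<delta>' \<in> f ` ?A"
      then obtain \<delta> where "\<delta> \<in> ?A" "\<delta>' = f \<delta>" by blast
      then show "\<delta>' \<in> ?A'"
        using matched[OF base(1), of \<delta>] matched[OF _ base(1), of \<delta>] f_in \<open>\<mu>' = f \<mu>\<close>
        unfolding matched_def by simp
    qed
    ultimately have "f ` ?A = ?A'" using X'.finite_points by (intro card_subset_eq) auto
    moreover have "\<omega>' \<in> ?A'" using \<gamma> \<omega>' unfolding matched_def by simp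
    ultimately show ?thesis by blast
  qed
  then have surj: "f ` \<Omega> = \<Omega>'" using f_in by blast
  have induced: "\<phi> s = map_prod f f ` s" if s: "s \<in> S" for s
  proof
    show "map_prod f f ` s \<subseteq> \<phi> s"
    proof
      fix p assume "p \<in> map_prod f f ` s"
      then obtain \<alpha> \<beta> where \<alpha>\<beta>: "(\<alpha>, \<beta>) \<in> s" "p = (f \<alpha>, f \<beta>)" by auto
      then have \<Omega>: "\<alpha> \<in> \<Omega>" "\<beta> \<in> \<Omega>" using X.basis_relation_subset[OF s] by auto
      have "\<phi> s = X'.R (f \<alpha>) (f \<beta>)"
        using matched[OF \<Omega>] X.basis_relation_of_eq[OF s \<alpha>\<beta>(1)] unfolding matched_def by simp
      then show "p \<in> \<phi> s" using X'.basis_relation_of(2) f_in \<Omega> \<alpha>\<beta>(2) by simp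
    qed
    show "\<phi> s \<subseteq> map_prod f f ` s"
    proof
      fix p assume p: "p \<in> \<phi> s"
      then have "p \<in> \<Omega>' \<times> \<Omega>'" using X'.basis_relation_subset[OF image_in[OF s]] by blast
      then obtain \<alpha> \<beta> where \<Omega>: "\<alpha> \<in> \<Omega>" "\<beta> \<in> \<Omega>" and \<alpha>\<beta>: "p = (f \<alpha>, f \<beta>)" using surj by auto
      have "\<phi> (X.R \<alpha> \<beta>) = \<phi> s"
        using matched[OF \<Omega>] X'.basis_relation_of_eq[OF image_in[OF s]] p \<alpha>\<beta>
        unfolding matched_def by simp
      then have "X.R \<alpha> \<beta> = s" using image_eq_iff X.basis_relation_of(1)[OF \<Omega>] s by blast
      then show "p \<in> map_prod f f ` s" using X.basis_relation_of(2)[OF \<Omega>] \<alpha>\<beta> by force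
    qed
  qed
  have "(\<lambda>s. map_prod f f ` s) ` S = \<phi> ` S" using induced by (intro image_cong) auto
  also have "\<dots> = S'"
    using algebraic_isomorphism unfolding algebraic_isomorphism_def bij_betw_def by blast
  finally show ?thesis
    using inj surj induced \<open>\<mu>' = f \<mu>\<close>
    unfolding isomorphism_def induced_by_def bij_betw_def by auto
qed

end

theorem theorem5p1:
  fixes \<Omega> :: "'a set" and S :: "('a \<times> 'a) set set" and n k c :: nat
  assumes "coherent_configuration \<Omega> S"
    and "n = card \<Omega>"
    and "k = maximal_valency S"
    and "c = indistinguishing_number \<Omega> S"
    and "n > 3 * c * (k - 1) * k"
  shows "(\<forall>\<mu>\<in>\<Omega>. \<forall>(\<Omega>' :: 'b set) S' \<phi>. \<forall>\<mu>'\<in>\<Omega>'.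
            coherent_configuration \<Omega>' S' \<longrightarrow>
            algebraic_isomorphism S S' \<phi> \<longrightarrow>
            \<phi> (basis_relation_of S \<mu> \<mu>) = basis_relation_of S' \<mu>' \<mu>' \<longrightarrow>
            (\<exists>f. isomorphism \<Omega> S \<Omega>' S' f \<and> induced_by S \<phi> f \<and> f \<mu> = \<mu>'))
       \<and> separable TYPE('b) \<Omega> S"
proof -
  interpret X: coherent_configuration \<Omega> S by fact
  have induced: "\<exists>f. isomorphism \<Omega> S \<Omega>' S' f \<and> induced_by S \<phi> f \<and> f \<mu> = \<mu>'"
    if "\<mu> \<in> \<Omega>" "\<mu>' \<in> \<Omega>'" "coherent_configuration \<Omega>' S'" "algebraic_isomorphism S S' \<phi>"
      "\<phi> (X.R \<mu> \<mu>) = basis_relation_of S' \<mu>' \<mu>'"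
    for \<Omega>' :: "'b set" and S' \<phi> \<mu> \<mu>'
  proof -
    interpret algebraically_isomorphic_configurations \<Omega> S \<Omega>' S' \<phi>
      using assms(1) that by (simp add: algebraically_isomorphic_configurations_def
          algebraically_isomorphic_configurations_axioms_def)
    interpret pointed_large_configuration \<Omega> S \<Omega>' S' \<phi> \<mu> \<mu>'
      using that assms by unfold_locales (simp_all add: matched_def)
    show ?thesis by (rule exists_inducing_isomorphism)
  qed
  have "separable TYPE('b) \<Omega> S"
    unfolding separable_def
  proof (intro allI impI)
    fix \<Omega>' :: "'b set" and S' \<phi>
    assume X': "coherent_configuration \<Omega>' S'" "algebraic_isomorphism S S' \<phi>"
    interpret algebraically_isomorphic_configurations \<Omega> S \<Omega>' S' \<phi>
      using assms(1) X' by (simp add: algebraically_isomorphic_configurations_def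
          algebraically_isomorphic_configurations_axioms_def)
    \<comment> \<open>The strict inequality forces positive degree, so a base point exists.\<close>
    have "\<Omega> \<noteq> {}" using assms(2,5) by auto
    then obtain \<mu> where \<mu>: "\<mu> \<in> \<Omega>" by blast
    \<comment> \<open>Any pair in the image of a diagonal colour is a loop, and its point can serve
      as \<open>\<mu>'\<close>.\<close>
    obtain \<alpha>' \<beta>' where \<alpha>': "\<alpha>' \<in> \<Omega>'" "\<beta>' \<in> \<Omega>'" "\<phi> (X.R \<mu> \<mu>) = X'.R \<alpha>' \<beta>'"
      using X'.basis_relation_nonempty[OF image_in[OF X.basis_relation_of(1)[OF \<mu> \<mu>]]] .
    then have "\<alpha>' = \<beta>'" using matched_refl \<mu> unfolding matched_def by blast
    then show "\<exists>f. isomorphism \<Omega> S \<Omega>' S' f \<and> induced_by S \<phi> f"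
      using induced[OF \<mu> \<alpha>'(1) X'] \<alpha>'(3) by blast
  qed
  with induced show ?thesis by blast
qed

end
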